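(* Let $X$ be a first countable topological space in which every closed subset is separable, let $x=(x_n)_{n\ge 1}$ be a sequence taking values in $X$, and let $\mathcal{I}$ be a generalized density ideal or an $F_\sigma$-ideal on $\mathbf{N}$. Then the set $$\{\omega\in(0,1]: \Lambda_{x\upharpoonright\omega}(\mathcal{I})=\Lambda_x(\mathcal{I})\}$$ is not meager if and only if $\Lambda_x(\mathcal{I})=\mathrm{L}_x$. Moreover, in this case, it is comeager.
   Context: $\mathbf{N}$ is the set of positive integers. An ideal on $\mathbf{N}$ is a family $\mathcal{I}\subseteq\mathcal{P}(\mathbf{N})$ closed under finite unions and subsets, with $\mathbf{N}\notin\mathcal{I}$ and containing the family $\mathrm{Fin}$ of all finite subsets of $\mathbf{N}$. $\mathcal{P}(\mathbf{N})$ carries the Cantor-space topology (sets identified with their characteristic functions in $\{0,1\}^{\mathbf{N}}$); an $F_\sigma$-ideal is an ideal that is an $F_\sigma$ subset of $\mathcal{P}(\mathbf{N})$. A submeasure is a function $\varphi:\mathcal{P}(\mathbf{N})\to[0,\infty]$ with $\varphi(\emptyset)=0$, $\varphi(\{n\})<\infty$ for all $n$, $\varphi(A)\le\varphi(B)$ whenever $A\subseteq B$, and $\varphi(A\cup B)\le\varphi(A)+\varphi(B)$. A generalized density ideal is an ideal of the form $\mathcal{Z}_\mu=\{A\subseteq\mathbf{N}: \lim_{n\to\infty}\mu_n(A\cap I_n)=0\}$, where $(I_n)_{n\ge1}$ is a partition of $\mathbf{N}$ into non-empty finite sets and $\mu=(\mu_n)_{n\ge1}$ is a sequence of submeasures such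 that each $\mu_n$ concentrates on $I_n$ (i.e. $\mu_n(A)=\mu_n(A\cap I_n)$ for all $A$) and $\limsup_n\mu_n(I_n)\ne0$. For a sequence $x=(x_n)$ in $X$, $\Lambda_x(\mathcal{I})$ is the set of $\mathcal{I}$-limit points of $x$: all $\ell\in X$ for which there is a subsequence $(x_{n_k})$ converging to $\ell$ with $\{n_k: k\in\mathbf{N}\}\notin\mathcal{I}$. $\mathrm{L}_x=\Lambda_x(\mathrm{Fin})$ is the set of ordinary limit points of $x$ (limits of subsequences of $x$). For $\omega\in(0,1]$ let $\sum_{i\ge1}d_i(\omega)2^{-i}$ be its unique non-terminating dyadic expansion, $d_i(\omega)\in\{0,1\}$ (infinitely many digits equal to $1$). If $n_1<n_2<\cdots$ enumerates $\{i: d_i(\omega)=1\}$, then $x\upharpoonright\omega$ denotes the subsequence $(x_{n_k})_{k\ge1}$, regarded as a sequence indexed by $k\in\mathbf{N}$. Meager (first category) and comeager (complement of a meager set) refer to $(0,1]$ with its usual topology. *)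

theory Defs
  imports "HOL-Analysis.Analysis"
begin

(* The positive integers are {1..} :: nat set. Sequences are functions on nat whose value
   at 0 is never used, and set families consist of subsets of {1..}. *)

definition ideal_on_N :: "nat set set \<Rightarrow> bool" where
  "ideal_on_N \<I> \<longleftrightarrow>
     \<I> \<subseteq> Pow {1..} \<and>
     (\<forall>A\<in>\<I>. \<forall>B\<in>\<I>. A \<union> B \<in> \<I>) \<and>
     (\<forall>A\<in>\<I>. \<forall>B. B \<subseteq> A \<longrightarrow> B \<in> \<I>) \<and>
     {1..} \<notin> \<I> \<and>
     (\<forall>A. A \<subseteq> {1..} \<and> finite A \<longrightarrow> A \<in> \<I>)"

definition Fin :: "nat set set" where
  "Fin = {A. A \<subseteq> {1..} \<and> finite A}"

definition cantor_topology :: "(nat \<Rightarrow> nat) topology" where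
  "cantor_topology = product_topology (\<lambda>_. discrete_topology {0, 1}) {1..}"

(* Members of the product are undefined outside {1..}, hence the restriction. *)
definition char_fun :: "nat set \<Rightarrow> nat \<Rightarrow> nat" where
  "char_fun A = restrict (indicator A) {1..}"

definition F_sigma_ideal :: "nat set set \<Rightarrow> bool" where
  "F_sigma_ideal \<I> \<longleftrightarrow> ideal_on_N \<I> \<and> fsigma_in cantor_topology (char_fun ` \<I>)"

definition submeasure :: "(nat set \<Rightarrow> ennreal) \<Rightarrow> bool" where
  "submeasure \<phi> \<longleftrightarrow>
     \<phi> {} = 0 \<and>
     (\<forall>n\<ge>1. \<phi> {n} < \<infinity>) \<and>
     (\<forall>A B. A \<subseteq> B \<and> B \<subseteq> {1..} \<longrightarrow> \<phi> A \<le> \<phi> B) \<and>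
     (\<forall>A B. A \<subseteq> {1..} \<and> B \<subseteq> {1..} \<longrightarrow> \<phi> (A \<union> B) \<le> \<phi> A + \<phi> B)"

definition finite_partition_seq :: "(nat \<Rightarrow> nat set) \<Rightarrow> bool" where
  "finite_partition_seq J \<longleftrightarrow>
     (\<forall>n\<ge>1. J n \<noteq> {} \<and> finite (J n)) \<and>
     disjoint_family_on J {1..} \<and>
     (\<Union>n\<in>{1..}. J n) = {1..}"

definition density_family ::
    "(nat \<Rightarrow> nat set) \<Rightarrow> (nat \<Rightarrow> nat set \<Rightarrow> ennreal) \<Rightarrow> nat set set" where
  "density_family J \<mu> = {A. A \<subseteq> {1..} \<and> (\<lambda>n. \<mu> n (A \<inter> J n)) \<longlonglongrightarrow> 0}"

definition generalized_density_ideal :: "nat set set \<Rightarrow> bool" where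
  "generalized_density_ideal \<I> \<longleftrightarrow>
     ideal_on_N \<I> \<and>
     (\<exists>J \<mu>. finite_partition_seq J \<and>
            (\<forall>n\<ge>1. submeasure (\<mu> n) \<and> (\<forall>A. A \<subseteq> {1..} \<longrightarrow> \<mu> n A = \<mu> n (A \<inter> J n))) \<and>
            limsup (\<lambda>n. \<mu> n (J n)) \<noteq> 0 \<and>
            \<I> = density_family J \<mu>)"

definition ideal_limit_points :: "(nat \<Rightarrow> 'a::topological_space) \<Rightarrow> nat set set \<Rightarrow> 'a set"
    ("\<Lambda>") where
  "\<Lambda> x \<I> = {l. \<exists>n. strict_mono_on {1..} n \<and> n ` {1..} \<subseteq> {1..} \<and>
                     (\<lambda>k. x (n k)) \<longlonglongrightarrow> l \<and> n ` {1..} \<notin> \<I>}"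

abbreviation limit_points :: "(nat \<Rightarrow> 'a::topological_space) \<Rightarrow> 'a set" where
  "limit_points x \<equiv> \<Lambda> x Fin"

definition is_dyadic_expansion :: "real \<Rightarrow> (nat \<Rightarrow> nat) \<Rightarrow> bool" where
  "is_dyadic_expansion \<omega> d \<longleftrightarrow>
     d 0 = 0 \<and> (\<forall>i. d i \<in> {0, 1}) \<and> infinite {i. d i = 1} \<and>
     (\<lambda>i. real (d (Suc i)) / 2 ^ Suc i) sums \<omega>"

(* The value at index 0 is pinned to 0 so that the sequence of digits is unique;
   see is_dyadic_expansion_ex1. *)
definition dyadic_digit :: "real \<Rightarrow> nat \<Rightarrow> nat" where
  "dyadic_digit \<omega> = (THE d. is_dyadic_expansion \<omega> d)"

(* enumerate counts from 0, while the index k of a subsequence starts at 1. *)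
definition subsequence_at :: "(nat \<Rightarrow> 'a) \<Rightarrow> real \<Rightarrow> nat \<Rightarrow> 'a" (infixl "\<restriction>" 95) where
  "(x \<restriction> \<omega>) k = x (enumerate {i. dyadic_digit \<omega> i = 1} (k - 1))"

definition nowhere_dense_in :: "'a topology \<Rightarrow> 'a set \<Rightarrow> bool" where
  "nowhere_dense_in T A \<longleftrightarrow> A \<subseteq> topspace T \<and> T interior_of (T closure_of A) = {}"

definition meager_in :: "'a topology \<Rightarrow> 'a set \<Rightarrow> bool" where
  "meager_in T A \<longleftrightarrow> (\<exists>\<F>. countable \<F> \<and> (\<forall>B\<in>\<F>. nowhere_dense_in T B) \<and> A = \<Union>\<F>)"

definition comeager_in :: "'a topology \<Rightarrow> 'a set \<Rightarrow> bool" where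
  "comeager_in T A \<longleftrightarrow> A \<subseteq> topspace T \<and> meager_in T (topspace T - A)"

lemma dyadic_partial_sum:
  assumes "is_dyadic_expansion \<omega> d"
  shows "(\<Sum>i<n. real (d (Suc i)) / 2 ^ Suc i) = (of_int \<lceil>2 ^ n * \<omega>\<rceil> - 1) / 2 ^ n"
proof -
  define f where "f = (\<lambda>i. real (d (Suc i)) / 2 ^ Suc i)"
  define S where "S = (\<Sum>i<n. f i)"
  have d01: "d i = 0 \<or> d i = 1" for i
    using assms by (auto simp: is_dyadic_expansion_def)
  have inf: "infinite {i. d i = 1}" and sm: "f sums \<omega>"
    using assms by (auto simp: is_dyadic_expansion_def f_def)
  have nonneg: "f i \<ge> 0" for i by (simp add: f_def)
  have summ: "summable f" and tot: "suminf f = \<omega>"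
    using sm by (auto simp: sums_iff)
  have "\<exists>i\<ge>Suc n. d i = 1"
    using inf unfolding infinite_nat_iff_unbounded_le by auto
  then obtain i where "i \<ge> n" "d (Suc i) = 1"
    by (metis Suc_le_D Suc_le_mono)
  then have fi: "f i > 0" by (simp add: f_def)
  have lt: "S < \<omega>"
    using sum_less_suminf2[OF summ, of n i] nonneg fi \<open>i \<ge> n\<close> tot by (simp add: S_def)
  have g: "(\<lambda>i. (1/2) ^ n * (1/2) ^ Suc i :: real) sums ((1/2) ^ n * 1)"
    by (rule sums_mult[OF power_half_series])
  have t: "(\<lambda>i. f (i + n)) sums (\<omega> - S)"
    using sums_split_initial_segment[OF sm, of n] by (simp add: S_def)
  have le: "\<omega> - S \<le> (1/2) ^ n * 1"
  proof (rule sums_le[OF _ t g])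
    fix i
    have "real (d (Suc (i + n))) \<le> 1" using d01[of "Suc (i + n)"] by auto
    then have "f (i + n) \<le> 1 / 2 ^ Suc (i + n)"
      unfolding f_def by (intro divide_right_mono) auto
    also have "\<dots> = (1/2) ^ n * (1/2) ^ Suc i"
      by (simp add: power_add power_divide)
    finally show "f (i + n) \<le> (1/2) ^ n * (1/2) ^ Suc i" .
  qed
  define m where "m = (\<Sum>i<n. d (Suc i) * 2 ^ (n - Suc i))"
  have m: "2 ^ n * S = real m"
    unfolding m_def S_def f_def sum_distrib_left of_nat_sum
  proof (rule sum.cong)
    fix i assume "i \<in> {..<n}"
    then have "(2::real) ^ n = 2 ^ (n - Suc i) * 2 ^ Suc i"
      by (simp flip: power_add del: power_Suc)
    then show "2 ^ n * (real (d (Suc i)) / 2 ^ Suc i) = real (d (Suc i) * 2 ^ (n - Suc i))"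
      by simp
  qed simp
  have "real m < 2 ^ n * \<omega>" using lt by (simp flip: m)
  moreover have "2 ^ n * \<omega> \<le> real m + 1"
    using le by (simp flip: m add: field_simps power_divide)
  ultimately have "\<lceil>2 ^ n * \<omega>\<rceil> = int m + 1" by (intro ceiling_unique) auto
  then have "of_int \<lceil>2 ^ n * \<omega>\<rceil> - 1 = 2 ^ n * S" using m by simp
  then show ?thesis by (simp add: S_def f_def)
qed

lemma is_dyadic_expansion_ex1:
  assumes "\<omega> \<in> {0<..1}"
  shows "\<exists>!d. is_dyadic_expansion \<omega> d"
proof (rule ex_ex1I)
  define c :: "nat \<Rightarrow> int" where "c n = \<lceil>2 ^ n * \<omega>\<rceil>" for n
  define d :: "nat \<Rightarrow> nat" where
    "d i = (case i of 0 \<Rightarrow> 0 | Suc j \<Rightarrow> nat (c (Suc j) - 2 * c j + 1))" for i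
  have c0: "c 0 = 1" using assms by (auto simp: c_def ceiling_eq_iff)
  have cb: "of_int (c n) - 1 < 2 ^ n * \<omega>" "2 ^ n * \<omega> \<le> of_int (c n)" for n
    by (auto simp: c_def) linarith
  have cS: "c (Suc j) = 2 * c j - 1 \<or> c (Suc j) = 2 * c j" for j
  proof -
    have "real_of_int (2 * c j - 2) < of_int (c (Suc j))"
      using cb[of j] cb[of "Suc j"] by simp
    moreover have "real_of_int (c (Suc j)) - 1 < of_int (2 * c j)"
      using cb[of j] cb[of "Suc j"] by simp
    ultimately show ?thesis by linarith
  qed
  have dS: "real (d (Suc j)) = of_int (c (Suc j)) - 2 * of_int (c j) + 1" for j
    using cS[of j] by (auto simp: d_def)
  have d01: "d i \<in> {0, 1}" for i
    using cS by (cases i) (auto simp: d_def, smt (verit) nat_1)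
  define f where "f = (\<lambda>i. real (d (Suc i)) / 2 ^ Suc i)"
  have ps: "(\<Sum>i<n. f i) = (of_int (c n) - 1) / 2 ^ n" for n
    by (induction n) (simp_all add: c0 f_def dS field_simps)
  have lim: "(\<lambda>n. \<omega> - (1/2) ^ n) \<longlonglongrightarrow> \<omega>"
    by (rule tendsto_eq_intros LIMSEQ_power_zero | simp)+
  have s: "f sums \<omega>"
    unfolding sums_def ps
  proof (rule tendsto_sandwich[OF _ _ lim tendsto_const])
    show "\<forall>\<^sub>F n in sequentially. \<omega> - (1/2) ^ n \<le> (of_int (c n) - 1) / 2 ^ n"
      using cb by (auto simp: field_simps power_divide)
    show "\<forall>\<^sub>F n in sequentially. (of_int (c n) - 1) / 2 ^ n \<le> \<omega>"
      using less_imp_le[OF cb(1)] by (auto simp: field_simps)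
  qed
  have "infinite {i. d i = 1}"
  proof
    assume "finite {i. d i = 1}"
    then obtain N where N: "\<And>i. d i = 1 \<Longrightarrow> i < N"
      using finite_nat_set_iff_bounded by auto
    have "f i = 0" if "i \<ge> N" for i
      using N[of "Suc i"] d01[of "Suc i"] that by (auto simp: f_def)
    then have "f sums (\<Sum>i<N. f i)" by (intro sums_finite) auto
    then have "\<omega> = (of_int (c N) - 1) / 2 ^ N" using s ps sums_unique2 by metis
    then show False using cb(1)[of N] by simp
  qed
  then have "is_dyadic_expansion \<omega> d"
    using s d01 by (simp add: is_dyadic_expansion_def f_def d_def)
  then show "\<exists>d. is_dyadic_expansion \<omega> d" by blast
next
  fix d e assume d: "is_dyadic_expansion \<omega> d" and e: "is_dyadic_expansion \<omega> e"
  have "d (Suc i) = e (Suc i)" for i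
    using dyadic_partial_sum[OF d, of "Suc i"] dyadic_partial_sum[OF e, of "Suc i"]
      dyadic_partial_sum[OF d, of i] dyadic_partial_sum[OF e, of i]
    by (simp add: field_simps)
  moreover have "d 0 = e 0" using d e by (simp add: is_dyadic_expansion_def)
  ultimately show "d = e" by (metis ext not0_implies_Suc)
qed

end

theory Submission
  imports Defs
begin

text \<open>
  Every limit point of \<open>x \<restriction> \<omega>\<close> is one of \<open>x\<close>, so \<open>\<Lambda> (x \<restriction> \<omega>) \<I> \<subseteq> limit_points x\<close> for all \<open>\<omega>\<close>.
  The heart of the matter is that equality holds for comeagerly many \<open>\<omega>\<close>, whatever \<open>\<Lambda> x \<I>\<close> is
  (\<open>comeager_limit_points_preserved\<close>). Both directions of the theorem follow: if \<open>\<Lambda> x \<I>\<close> is the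
  full set of limit points, then the set in question is this comeager set, which is not meager by
  the Baire category theorem; if not, then it is disjoint from this comeager set, hence meager.

  The ideal enters through the combinatorial property in Talagrand's characterization of meager
  ideals: there are finite blocks \<open>J n\<close>, moving off to infinity, such that the union of any
  infinitely many of them is outside \<open>\<I>\<close>. For a generalized density ideal, the blocks are pieces of
  the partition whose submeasure stays above a positive constant; for an \<open>F\<^sub>\<sigma>\<close>-ideal, they are
  intervals so long that no set containing the \<open>n\<close>th one belongs to the \<open>n\<close>th closed set in an
  increasing union of closed sets exhausting the ideal.

  Fix an open set \<open>U\<close> that \<open>x\<close> visits infinitely often. After any finite string of digits one can
  continue by choosing only indices \<open>i\<close> with \<open>x i \<in> U\<close>, until \<open>x \<restriction> \<omega>\<close> stays in \<open>U\<close> on a whole block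
  \<open>J n\<close> with \<open>n\<close> large. So for generic \<open>\<omega>\<close> this happens for infinitely many \<open>n\<close>, and simultaneously
  for countably many \<open>U\<close>. By separability of the closed set of cluster points and first
  countability, countably many such \<open>U\<close> suffice to find one inside each neighbourhood of each cluster
  point \<open>l\<close>. Running through a countable neighbourhood base at \<open>l\<close> and picking one block for each
  neighbourhood gives a set of indices outside \<open>\<I>\<close> along which \<open>x \<restriction> \<omega>\<close> converges to \<open>l\<close>. The
  diagonal choice is made inside one \<open>\<omega>\<close>, so it covers uncountably many \<open>l\<close> at once.
\<close>

section \<open>Blocks that escape the ideal\<close>

definition escaping_blocks :: "nat set set \<Rightarrow> (nat \<Rightarrow> nat set) \<Rightarrow> bool" where
  "escaping_blocks \<I> J \<longleftrightarrow>
     (\<forall>n. finite (J n) \<and> J n \<subseteq> {n<..}) \<and> (\<forall>M. infinite M \<longrightarrow> (\<Union>n\<in>M. J n) \<notin> \<I>)"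

text \<open>
  A nonzero limit superior yields an \<open>\<epsilon> > 0\<close> with \<open>\<mu> n (J n) > \<epsilon>\<close> for infinitely many \<open>n\<close>; a set
  containing infinitely many of these pieces violates \<open>\<mu> n (A \<inter> J n) \<longlonglongrightarrow> 0\<close>. As the pieces are
  disjoint, only finitely many of them meet a given initial segment.
\<close>

lemma density_family_has_escaping_blocks:
  assumes part: "finite_partition_seq J"
    and lim: "limsup (\<lambda>n. \<mu> n (J n)) \<noteq> 0"
  shows "\<exists>B. escaping_blocks (density_family J \<mu>) B"
proof -
  have J: "finite (J n)" "J n \<noteq> {}" "J n \<subseteq> {1..}" if "n \<ge> 1" for n
    using part that unfolding finite_partition_seq_def by auto
  obtain \<epsilon> where \<epsilon>: "0 < \<epsilon>" "\<epsilon> < limsup (\<lambda>n. \<mu> n (J n))"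
    using lim dense by (metis not_gr_zero)
  have large: "\<exists>\<^sub>F n in sequentially. \<epsilon> < \<mu> n (J n)"
  proof (rule ccontr)
    assume "\<not> ?thesis"
    then have "\<forall>\<^sub>F n in sequentially. \<mu> n (J n) \<le> \<epsilon>"
      by (simp add: not_frequently not_less)
    then have "limsup (\<lambda>n. \<mu> n (J n)) \<le> \<epsilon>" by (rule Limsup_bounded)
    with \<epsilon> show False by simp
  qed
  have "\<exists>n\<ge>1. \<epsilon> < \<mu> n (J n) \<and> J n \<subseteq> {m<..}" for m
  proof -
    have "\<exists>n. n \<ge> 1 \<and> i \<in> J n" if "i \<in> {1..m}" for i
    proof -
      have "i \<in> (\<Union>n\<in>{1..}. J n)" using part that by (simp add: finite_partition_seq_def)
      then show ?thesis by auto
    qed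
    then obtain idx where idx: "\<And>i. i \<in> {1..m} \<Longrightarrow> idx i \<ge> 1 \<and> i \<in> J (idx i)"
      by metis
    have "{n. n \<ge> 1 \<and> \<not> J n \<subseteq> {m<..}} \<subseteq> idx ` {1..m}"
    proof
      fix n assume "n \<in> {n. n \<ge> 1 \<and> \<not> J n \<subseteq> {m<..}}"
      then obtain i where n: "1 \<le> n" and i: "i \<in> J n" "\<not> m < i" by auto
      then have "i \<in> {1..m}" using J(3)[OF n] by auto
      moreover have "idx i = n"
      proof (rule ccontr)
        assume "idx i \<noteq> n"
        then have "J (idx i) \<inter> J n = {}"
          using part idx[OF \<open>i \<in> {1..m}\<close>] n
          unfolding finite_partition_seq_def disjoint_family_on_def by auto
        then show False using idx[OF \<open>i \<in> {1..m}\<close>] i by auto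
      qed
      ultimately show "n \<in> idx ` {1..m}" by blast
    qed
    then have "finite {n. n \<ge> 1 \<and> \<not> J n \<subseteq> {m<..}}" by (rule finite_subset) simp
    \<comment> \<open>Index \<open>0\<close> lies outside the partition and has to be discarded as well.\<close>
    then have "finite ({n. n \<ge> 1 \<and> \<not> J n \<subseteq> {m<..}} \<union> {0})" by simp
    moreover have "infinite {n. \<epsilon> < \<mu> n (J n)}"
      using large by (simp add: frequently_cofinite flip: cofinite_eq_sequentially)
    ultimately have "infinite ({n. \<epsilon> < \<mu> n (J n)} - ({n. n \<ge> 1 \<and> \<not> J n \<subseteq> {m<..}} \<union> {0}))"
      by (rule Diff_infinite_finite)
    then have "{n. \<epsilon> < \<mu> n (J n)} - ({n. n \<ge> 1 \<and> \<not> J n \<subseteq> {m<..}} \<union> {0}) \<noteq> {}"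
      by (rule infinite_imp_nonempty)
    then obtain n where "n \<in> {n. \<epsilon> < \<mu> n (J n)} - ({n. n \<ge> 1 \<and> \<not> J n \<subseteq> {m<..}} \<union> {0})"
      by (meson ex_in_conv)
    then show ?thesis by (intro exI[of _ n]) auto
  qed
  then obtain h where h: "\<And>m. h m \<ge> 1 \<and> \<epsilon> < \<mu> (h m) (J (h m)) \<and> J (h m) \<subseteq> {m<..}"
    by metis
  have "(\<Union>m\<in>M. J (h m)) \<notin> density_family J \<mu>" if M: "infinite M" for M
  proof
    let ?A = "\<Union>m\<in>M. J (h m)"
    assume "?A \<in> density_family J \<mu>"
    then have "(\<lambda>n. \<mu> n (?A \<inter> J n)) \<longlonglongrightarrow> 0" by (simp add: density_family_def)
    then have small: "\<forall>\<^sub>F n in sequentially. \<mu> n (?A \<inter> J n) < \<epsilon>"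
      using \<epsilon>(1) by (rule order_tendstoD)
    \<comment> \<open>A nonempty piece cannot lie beyond arbitrarily large \<open>m\<close>, so \<open>h\<close> takes each value finitely
      often.\<close>
    have "infinite (h ` M)"
    proof
      assume "finite (h ` M)"
      then obtain n where n: "n \<in> h ` M" "infinite (h -` {n} \<inter> M)"
        using M by (rule inf_img_fin_domE')
      obtain e where "e \<in> J n" using J(2)[of n] n(1) h by auto
      then have "h -` {n} \<inter> M \<subseteq> {..<e}" using h by fastforce
      then show False using n(2) finite_subset by blast
    qed
    moreover have "finite {n. \<not> \<mu> n (?A \<inter> J n) < \<epsilon>}"
      using small by (simp add: eventually_cofinite flip: cofinite_eq_sequentially)
    ultimately obtain n where n: "n \<in> h ` M" "\<mu> n (?A \<inter> J n) < \<epsilon>"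
      by (metis (no_types, lifting) finite_subset mem_Collect_eq subsetI)
    moreover have "?A \<inter> J n = J n" using n(1) by auto
    ultimately show False using h by (metis imageE order.asym)
  qed
  then have "escaping_blocks (density_family J \<mu>) (\<lambda>m. J (h m))"
    unfolding escaping_blocks_def using h J(1) by blast
  then show ?thesis by blast
qed

lemma char_fun_in_cantor_space: "char_fun A \<in> topspace cantor_topology"
  by (auto simp: char_fun_def cantor_topology_def indicator_def)

lemma char_fun_eq_iff:
  assumes "A \<subseteq> {1..}" "B \<subseteq> {1..}"
  shows "char_fun A = char_fun B \<longleftrightarrow> A = B"
proof
  assume eq: "char_fun A = char_fun B"
  have "i \<in> A \<longleftrightarrow> i \<in> B" if "i \<ge> 1" for i
    using fun_cong[OF eq, of i] that by (cases "i \<in> A"; cases "i \<in> B") (simp_all add: char_fun_def)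
  then show "A = B" using assms by auto
qed simp

text \<open>
  An open set around a point of the Cantor space constrains only finitely many coordinates.
\<close>

lemma closed_avoided_by_initial_segment:
  assumes K: "closedin cantor_topology K" and "char_fun B \<notin> K"
  shows "\<exists>q. \<forall>A. A \<inter> {1..q} = B \<inter> {1..q} \<longrightarrow> char_fun A \<notin> K"
proof -
  let ?T = "\<lambda>_::nat. discrete_topology {0, 1::nat}"
  define W where "W = topspace cantor_topology - K"
  have "openin cantor_topology W"
    unfolding W_def using K by blast
  then have "\<forall>v\<in>W. \<exists>U. finite {i \<in> {1..}. U i \<noteq> topspace (?T i)} \<and>
      (\<forall>i\<in>{1..}. openin (?T i) (U i)) \<and> v \<in> Pi\<^sub>E {1..} U \<and> Pi\<^sub>E {1..} U \<subseteq> W"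
    unfolding cantor_topology_def openin_product_topology_alt .
  moreover have "char_fun B \<in> W"
    unfolding W_def using assms(2) char_fun_in_cantor_space by blast
  ultimately obtain U where fin: "finite {i \<in> {1..}. U i \<noteq> topspace (?T i)}"
    and U: "char_fun B \<in> Pi\<^sub>E {1..} U" "Pi\<^sub>E {1..} U \<subseteq> W"
    by blast
  have "\<exists>q. \<forall>i\<in>{i \<in> {1..}. U i \<noteq> topspace (?T i)}. i \<le> q"
    using fin by (simp only: finite_nat_set_iff_bounded_le)
  then obtain q where q: "\<forall>i\<in>{i \<in> {1..}. U i \<noteq> topspace (?T i)}. i \<le> q" by (rule exE)
  have "char_fun A \<notin> K" if A: "A \<inter> {1..q} = B \<inter> {1..q}" for A
  proof -
    have "char_fun A i \<in> U i" if i: "i \<ge> 1" for i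
    proof (cases "i \<le> q")
      case True
      moreover have "i \<in> A \<inter> {1..q} \<longleftrightarrow> i \<in> B \<inter> {1..q}" using A by simp
      ultimately have "i \<in> A \<longleftrightarrow> i \<in> B" using i by simp
      then have "char_fun A i = char_fun B i" by (simp add: char_fun_def indicator_def)
      then show ?thesis using U(1) i by auto
    next
      case False
      then have "U i = topspace (?T i)" using q i by blast
      then show ?thesis using i by (simp add: char_fun_def indicator_def)
    qed
    then have "char_fun A \<in> Pi\<^sub>E {1..} U"
      by (auto simp: PiE_iff char_fun_def extensional_def)
    then show ?thesis using U(2) by (auto simp: W_def)
  qed
  then show ?thesis by blast
qed

text \<open>
  For each of the finitely many traces \<open>s\<close> on \<open>{1..p}\<close>, the set \<open>s \<union> {p<..}\<close> is cofinite, hence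
  outside the ideal, and a finite part of it suffices to see that it is outside \<open>K\<close>. The largest of
  the resulting bounds works for all traces.
\<close>

lemma closed_part_of_ideal_avoided_by_interval:
  assumes id: "ideal_on_N \<I>" and K: "closedin cantor_topology K" "K \<subseteq> char_fun ` \<I>"
  shows "\<exists>q>p. \<forall>A \<subseteq> {1..}. {p<..q} \<subseteq> A \<longrightarrow> char_fun A \<notin> K"
proof -
  have "\<exists>q. \<forall>A. A \<inter> {1..q} = (s \<union> {p<..}) \<inter> {1..q} \<longrightarrow> char_fun A \<notin> K"
    if s: "s \<subseteq> {1..p}" for s
  proof (rule closed_avoided_by_initial_segment[OF K(1)])
    show "char_fun (s \<union> {p<..}) \<notin> K"
    proof
      assume "char_fun (s \<union> {p<..}) \<in> K"
      then obtain A where A: "A \<in> \<I>" "char_fun (s \<union> {p<..}) = char_fun A"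
        using K(2) by blast
      have "A \<subseteq> {1..}" using id A(1) by (auto simp: ideal_on_N_def)
      moreover have "s \<union> {p<..} \<subseteq> {1..}" using s by auto
      ultimately have "s \<union> {p<..} \<in> \<I>" using A char_fun_eq_iff by metis
      moreover have "{1..p} \<in> \<I>" using id by (simp add: ideal_on_N_def)
      ultimately have "(s \<union> {p<..}) \<union> {1..p} \<in> \<I>" using id by (simp add: ideal_on_N_def)
      moreover have "(s \<union> {p<..}) \<union> {1..p} = {1..}" using s by auto
      ultimately show False using id by (simp add: ideal_on_N_def)
    qed
  qed
  then obtain b where b: "\<And>s A. s \<subseteq> {1..p} \<Longrightarrow>
      A \<inter> {1..b s} = (s \<union> {p<..}) \<inter> {1..b s} \<Longrightarrow> char_fun A \<notin> K"
    by metis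
  have "finite (b ` Pow {1..p})" by simp
  then obtain c where c: "\<And>s. s \<subseteq> {1..p} \<Longrightarrow> b s \<le> c"
    unfolding finite_nat_set_iff_bounded_le by auto
  have "char_fun A \<notin> K" if A: "A \<subseteq> {1..}" "{p<..max c (Suc p)} \<subseteq> A" for A
  proof (rule b)
    show "A \<inter> {1..p} \<subseteq> {1..p}" by blast
    have "b (A \<inter> {1..p}) \<le> c" by (rule c) blast
    then show "A \<inter> {1..b (A \<inter> {1..p})} = (A \<inter> {1..p} \<union> {p<..}) \<inter> {1..b (A \<inter> {1..p})}"
      using A by (auto simp: subset_iff)
  qed
  then show ?thesis by (intro exI[of _ "max c (Suc p)"]) auto
qed

lemma F_sigma_ideal_has_escaping_blocks:
  assumes "F_sigma_ideal \<I>"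
  shows "\<exists>J. escaping_blocks \<I> J"
proof -
  have id: "ideal_on_N \<I>" using assms by (simp add: F_sigma_ideal_def)
  have "fsigma_in cantor_topology (char_fun ` \<I>)" using assms by (simp add: F_sigma_ideal_def)
  then obtain C where "(\<forall>n. closedin cantor_topology (C n)) \<and> (\<forall>n. C n \<subseteq> C (Suc n)) \<and>
      \<Union> (range C) = char_fun ` \<I>"
    unfolding fsigma_in_ascending by (rule exE)
  then have C: "\<And>n. closedin cantor_topology (C n)" "\<And>n. C n \<subseteq> C (Suc n)"
      "\<Union> (range C) = char_fun ` \<I>"
    by simp_all
  have "\<exists>q>p. \<forall>A \<subseteq> {1..}. {p<..q} \<subseteq> A \<longrightarrow> char_fun A \<notin> C n" for p n
  proof (rule closed_part_of_ideal_avoided_by_interval[OF id C(1)])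
    show "C n \<subseteq> char_fun ` \<I>" using C(3) by blast
  qed
  then obtain Q where Q: "\<And>p n. Q p n > p"
      "\<And>p n A. A \<subseteq> {1..} \<Longrightarrow> {p<..Q p n} \<subseteq> A \<Longrightarrow> char_fun A \<notin> C n"
    by metis
  define P where "P = rec_nat 0 (\<lambda>n p. Q p n)"
  have P_Suc: "P (Suc n) = Q (P n) n" for n by (simp add: P_def)
  have P_ge: "n \<le> P n" for n
  proof (induction n)
    case (Suc n)
    then show ?case using Q(1)[of "P n" n] by (simp add: P_Suc)
  qed simp
  have mono: "C n \<subseteq> C m" if "n \<le> m" for n m
    using C(2) that by (rule lift_Suc_mono_le)
  have "(\<Union>n\<in>M. {P n<..P (Suc n)}) \<notin> \<I>" if M: "infinite M" for M
  proof
    let ?A = "\<Union>n\<in>M. {P n<..P (Suc n)}"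
    assume "?A \<in> \<I>"
    then obtain k where k: "char_fun ?A \<in> C k" using C(3) by blast
    obtain n where n: "n \<in> M" "n \<ge> k" using M unfolding infinite_nat_iff_unbounded_le by blast
    have "char_fun ?A \<notin> C n"
      by (rule Q(2)[of _ "P n"]) (use n(1) in \<open>auto simp flip: P_Suc\<close>)
    then show False using k mono[OF n(2)] by blast
  qed
  moreover have "{P n<..P (Suc n)} \<subseteq> {n<..}" for n using P_ge[of n] by auto
  ultimately have "escaping_blocks \<I> (\<lambda>n. {P n<..P (Suc n)})"
    unfolding escaping_blocks_def by simp
  then show ?thesis by blast
qed

section \<open>Meager sets and the Baire category theorem\<close>

lemma meager_in_Union:
  assumes "countable \<N>" "\<And>B. B \<in> \<N> \<Longrightarrow> nowhere_dense_in T B" "A \<subseteq> \<Union>\<N>"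
  shows "meager_in T A"
  unfolding meager_in_def
proof (intro exI conjI ballI)
  show "countable ((\<lambda>B. A \<inter> B) ` \<N>)" using assms(1) by simp
  show "A = \<Union> ((\<lambda>B. A \<inter> B) ` \<N>)" using assms(3) by auto
  fix B assume "B \<in> (\<lambda>B. A \<inter> B) ` \<N>"
  then obtain C where C: "C \<in> \<N>" "B = A \<inter> C" by blast
  have "T interior_of (T closure_of B) \<subseteq> T interior_of (T closure_of C)"
    using C(2) by (intro interior_of_mono closure_of_mono) blast
  then show "nowhere_dense_in T B"
    using assms(2)[OF C(1)] C(2) by (auto simp: nowhere_dense_in_def)
qed

lemma meager_in_subset:
  assumes "meager_in T B" "A \<subseteq> B"
  shows "meager_in T A"
proof -
  obtain \<F> where "countable \<F>" "\<forall>N\<in>\<F>. nowhere_dense_in T N" "B = \<Union>\<F>"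
    using assms(1) unfolding meager_in_def by blast
  then show ?thesis using assms(2) by (intro meager_in_Union[of \<F>]) auto
qed

lemma meager_in_Un:
  assumes "meager_in T A" "meager_in T B"
  shows "meager_in T (A \<union> B)"
proof -
  obtain \<F> \<G> where F: "countable \<F>" "\<forall>N\<in>\<F>. nowhere_dense_in T N" "A = \<Union>\<F>"
    and G: "countable \<G>" "\<forall>N\<in>\<G>. nowhere_dense_in T N" "B = \<Union>\<G>"
    using assms unfolding meager_in_def by blast
  show ?thesis by (rule meager_in_Union[of "\<F> \<union> \<G>"]) (use F G in auto)
qed

lemma unit_interval_not_meager: "\<not> meager_in (top_of_set {0<..1::real}) {0<..1}"
proof
  let ?T = "top_of_set {0<..1::real}"
  assume "meager_in ?T {0<..1}"
  then obtain \<F> where F: "countable \<F>" "\<forall>N\<in>\<F>. nowhere_dense_in ?T N" "{0<..1} = \<Union>\<F>"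
    unfolding meager_in_def by blast
  \<comment> \<open>The half-open interval is an open piece of the complete space \<open>{0..1}\<close>.\<close>
  have "completely_metrizable_space (subtopology (top_of_set {0..1::real}) {0<..1})"
  proof (rule completely_metrizable_space_openin)
    show "completely_metrizable_space (top_of_set {0..1::real})"
      by (intro completely_metrizable_space_closedin completely_metrizable_space_euclidean) simp
    show "openin (top_of_set {0..1::real}) {0<..1}"
      unfolding openin_open by (intro exI[of _ "{0<..}"]) auto
  qed
  then have "completely_metrizable_space ?T"
    by (simp add: subtopology_subtopology Int_absorb1 greaterThanAtMost_subseteq_atLeastAtMost_iff)
  moreover have "countable ((closure_of) ?T ` \<F>)" using F(1) by simp
  moreover have "closedin ?T N \<and> ?T interior_of N = {}" if "N \<in> (closure_of) ?T ` \<F>" for N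
    using that F(2) by (auto simp: nowhere_dense_in_def)
  ultimately have "?T interior_of \<Union>((closure_of) ?T ` \<F>) = {}"
    by (intro Baire_category_alt) auto
  moreover have "{0<..1} \<subseteq> \<Union>((closure_of) ?T ` \<F>)"
  proof
    fix w :: real assume "w \<in> {0<..1}"
    then obtain N where N: "N \<in> \<F>" "w \<in> N" using F(3) by blast
    then have "N \<subseteq> ?T closure_of N"
      using F(2) by (intro closure_of_subset) (auto simp: nowhere_dense_in_def)
    then show "w \<in> \<Union>((closure_of) ?T ` \<F>)" using N by blast
  qed
  then have "?T interior_of {0<..1} \<subseteq> ?T interior_of \<Union>((closure_of) ?T ` \<F>)"
    by (rule interior_of_mono)
  moreover have "?T interior_of {0<..1} = {0<..1}"
    using interior_of_topspace[of ?T] by simp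
  ultimately show False by force
qed

section \<open>Dyadic digits\<close>

definition digit_set :: "real \<Rightarrow> nat set" where
  "digit_set \<omega> = {i. dyadic_digit \<omega> i = 1}"

lemma dyadic_digit_expansion:
  assumes "\<omega> \<in> {0<..1}"
  shows "is_dyadic_expansion \<omega> (dyadic_digit \<omega>)"
  unfolding dyadic_digit_def by (rule theI'[OF is_dyadic_expansion_ex1[OF assms]])

lemma digit_set_infinite:
  assumes "\<omega> \<in> {0<..1}"
  shows "infinite (digit_set \<omega>)"
  using dyadic_digit_expansion[OF assms] by (simp add: is_dyadic_expansion_def digit_set_def)

lemma zero_notin_digit_set:
  assumes "\<omega> \<in> {0<..1}"
  shows "0 \<notin> digit_set \<omega>"
  using dyadic_digit_expansion[OF assms] by (simp add: is_dyadic_expansion_def digit_set_def)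

lemma digit_set_surj:
  assumes inf: "infinite E" and "0 \<notin> E"
  shows "\<exists>\<omega>\<in>{0<..1}. digit_set \<omega> = E"
proof -
  define d :: "nat \<Rightarrow> nat" where "d i = (if i \<in> E then 1 else 0)" for i
  define f where "f = (\<lambda>i. real (d (Suc i)) / 2 ^ Suc i)"
  have bound: "0 \<le> f i" "f i \<le> (1/2) ^ Suc i" for i
    by (auto simp: f_def d_def power_divide)
  have summ: "summable f"
    using bound by (intro summable_comparison_test'[OF sums_summable[OF power_half_series]]) auto
  then have sm: "f sums suminf f" by (rule summable_sums)
  have "suminf f \<le> 1" using sums_le[OF bound(2) sm power_half_series] .
  moreover have "suminf f > 0"
  proof -
    obtain i where "i \<in> E" using inf by fastforce
    then obtain j where "Suc j \<in> E" using assms(2) by (cases i) auto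
    then have "f j > 0" by (simp add: f_def d_def)
    then show ?thesis using suminf_pos2[OF summ] bound(1) by blast
  qed
  ultimately have w: "suminf f \<in> {0<..1}" by simp
  have "is_dyadic_expansion (suminf f) d"
    using assms sm by (simp add: is_dyadic_expansion_def d_def f_def)
  then have "dyadic_digit (suminf f) = d"
    using is_dyadic_expansion_ex1[OF w] dyadic_digit_expansion[OF w] by blast
  then have "digit_set (suminf f) = E" by (auto simp: digit_set_def d_def)
  with w show ?thesis by blast
qed

lemma dyadic_digit_eq_iff:
  assumes "\<omega> \<in> {0<..1}" "\<omega>' \<in> {0<..1}"
  shows "dyadic_digit \<omega> i = dyadic_digit \<omega>' i \<longleftrightarrow> (i \<in> digit_set \<omega> \<longleftrightarrow> i \<in> digit_set \<omega>')"
proof -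
  have "dyadic_digit \<omega> i \<in> {0, 1}" "dyadic_digit \<omega>' i \<in> {0, 1}"
    using assms[THEN dyadic_digit_expansion] by (auto simp: is_dyadic_expansion_def)
  then show ?thesis by (auto simp: digit_set_def)
qed

lemma ceiling_eq_if_digits_agree:
  assumes w: "\<omega> \<in> {0<..1}" "\<omega>' \<in> {0<..1}"
    and agree: "digit_set \<omega> \<inter> {..q} = digit_set \<omega>' \<inter> {..q}"
  shows "\<lceil>2 ^ q * \<omega>\<rceil> = \<lceil>2 ^ q * \<omega>'\<rceil>"
proof -
  have "dyadic_digit \<omega> (Suc i) = dyadic_digit \<omega>' (Suc i)" if "i < q" for i
  proof -
    have "Suc i \<in> {..q}" using that by simp
    then have "Suc i \<in> digit_set \<omega> \<longleftrightarrow> Suc i \<in> digit_set \<omega>'" using agree by blast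
    then show ?thesis using dyadic_digit_eq_iff[OF w] by blast
  qed
  then have "(\<Sum>i<q. real (dyadic_digit \<omega> (Suc i)) / 2 ^ Suc i)
      = (\<Sum>i<q. real (dyadic_digit \<omega>' (Suc i)) / 2 ^ Suc i)" by simp
  then show ?thesis
    using w[THEN dyadic_digit_expansion, THEN dyadic_partial_sum] by simp
qed

text \<open>
  Since \<open>\<lceil>2 ^ Suc q * \<omega>\<rceil> = 2 * \<lceil>2 ^ q * \<omega>\<rceil> - 1 + d\<close>, where \<open>d \<in> {0, 1}\<close> is the next digit, the value
  at \<open>Suc q\<close> determines \<open>d\<close> by its parity, and then the value at \<open>q\<close>.
\<close>

lemma digits_agree_if_ceiling_eq:
  assumes w: "\<omega> \<in> {0<..1}" "\<omega>' \<in> {0<..1}"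
    and "\<lceil>2 ^ q * \<omega>\<rceil> = \<lceil>2 ^ q * \<omega>'\<rceil>"
  shows "digit_set \<omega> \<inter> {..q} = digit_set \<omega>' \<inter> {..q}"
  using assms(3)
proof (induction q)
  case 0
  then show ?case using zero_notin_digit_set w by auto
next
  case (Suc q)
  have step: "\<lceil>2 ^ Suc q * v\<rceil> = 2 * \<lceil>2 ^ q * v\<rceil> - 1 + int (dyadic_digit v (Suc q))"
    if "v \<in> {0<..1}" for v
  proof -
    note ps = dyadic_partial_sum[OF dyadic_digit_expansion[OF that]]
    have "real_of_int \<lceil>2 ^ Suc q * v\<rceil>
        = of_int (2 * \<lceil>2 ^ q * v\<rceil> - 1 + int (dyadic_digit v (Suc q)))"
      using ps[of "Suc q"] ps[of q] by (simp add: field_simps)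
    then show ?thesis by linarith
  qed
  have digit: "dyadic_digit v (Suc q) = 0 \<or> dyadic_digit v (Suc q) = 1" if "v \<in> {0<..1}" for v
    using dyadic_digit_expansion[OF that] by (simp add: is_dyadic_expansion_def)
  have "\<lceil>2 ^ q * \<omega>\<rceil> = \<lceil>2 ^ q * \<omega>'\<rceil>"
    using Suc.prems step[OF w(1)] step[OF w(2)] digit[OF w(1)] digit[OF w(2)] by linarith
  moreover from this have "dyadic_digit \<omega> (Suc q) = dyadic_digit \<omega>' (Suc q)"
    using Suc.prems step[OF w(1)] step[OF w(2)] by linarith
  ultimately have "digit_set \<omega> \<inter> {..q} = digit_set \<omega>' \<inter> {..q}"
    and "Suc q \<in> digit_set \<omega> \<longleftrightarrow> Suc q \<in> digit_set \<omega>'"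
    using Suc.IH by (simp_all add: digit_set_def)
  then show ?case by (auto simp: atMost_Suc)
qed

lemma enumerate_cong_initial_segment:
  fixes E F :: "nat set"
  assumes inf: "infinite E" "infinite F" and agree: "E \<inter> {..q} = F \<inter> {..q}"
    and "enumerate E j \<le> q"
  shows "enumerate F j = enumerate E j"
  using assms(4)
proof (induction j)
  case 0
  have in_F: "enumerate E 0 \<in> F" using 0 agree enumerate_in_set[OF inf(1)] by blast
  show ?case unfolding enumerate_0[of F]
  proof (rule Least_equality)
    show "enumerate E 0 \<in> F" by (rule in_F)
    fix y assume "y \<in> F"
    show "enumerate E 0 \<le> y"
    proof (rule ccontr)
      assume *: "\<not> ?thesis"
      then have "y \<in> E \<inter> {..q}" unfolding agree using \<open>y \<in> F\<close> 0 by simp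
      then show False using * by (simp add: enumerate_0 Least_le)
    qed
  qed
next
  case (Suc j)
  have less: "enumerate E j < enumerate E (Suc j)" using inf(1) by simp
  then have IH: "enumerate F j = enumerate E j" using Suc by simp
  have in_F: "enumerate E (Suc j) \<in> F" using Suc.prems agree enumerate_in_set[OF inf(1)] by blast
  show ?case unfolding enumerate_Suc''[OF inf(2)] IH
  proof (rule Least_equality)
    show "enumerate E (Suc j) \<in> F \<and> enumerate E j < enumerate E (Suc j)" using in_F less by simp
    fix y assume y: "y \<in> F \<and> enumerate E j < y"
    show "enumerate E (Suc j) \<le> y"
    proof (rule ccontr)
      assume *: "\<not> ?thesis"
      then have "y \<in> E \<inter> {..q}" unfolding agree using y Suc.prems by simp
      then show False using * y by (simp add: enumerate_Suc''[OF inf(1)] Least_le)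
    qed
  qed
qed

lemma less_enumerate:
  fixes E :: "nat set"
  assumes inf: "infinite E" and "0 \<notin> E"
  shows "j < enumerate E j"
proof (induction j)
  case 0
  then show ?case using enumerate_in_set[OF inf, of 0] assms(2) by (metis gr0I)
next
  case (Suc j)
  then show ?case using enumerate_step[OF inf, of j] by simp
qed

section \<open>Generic subsequences\<close>

text \<open>
  Near any \<open>\<omega>\<^sub>0\<close> keep its first \<open>p\<close> digits and afterwards choose only indices \<open>i\<close> with \<open>x i \<in> U\<close>. At
  most \<open>p\<close> terms of the subsequence come from the kept digits, so all terms with index in a block
  \<open>J n\<close>, \<open>n \<ge> p\<close>, lie in \<open>U\<close>. This is decided by finitely many digits, that is, on a whole open
  dyadic interval.
\<close>

lemma block_in_open_set_generic:
  fixes x :: "nat \<Rightarrow> 'a::topological_space"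
  assumes J: "\<And>n. finite (J n)" "\<And>n. J n \<subseteq> {n<..}"
    and visits: "infinite {i. i \<ge> 1 \<and> x i \<in> U}"
  shows "nowhere_dense_in (top_of_set {0<..1})
           {\<omega> \<in> {0<..1}. \<not> (\<exists>n\<ge>m. \<forall>k\<in>J n. (x \<restriction> \<omega>) k \<in> U)}"
    (is "nowhere_dense_in ?T ?B")
proof -
  have "\<not> W \<subseteq> ?T closure_of ?B" if W: "openin ?T W" "\<omega>\<^sub>0 \<in> W" for W \<omega>\<^sub>0
  proof
    assume sub: "W \<subseteq> ?T closure_of ?B"
    have w0: "\<omega>\<^sub>0 \<in> {0<..1}" using openin_subset[OF W(1)] W(2) by auto
    obtain e where e: "e > 0" "ball \<omega>\<^sub>0 e \<inter> {0<..1} \<subseteq> W"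
      using W by (meson openin_contains_ball)
    obtain p where p: "(1/2) ^ p < e" using real_arch_pow_inv[OF e(1)] by fastforce
    define E where "E = digit_set \<omega>\<^sub>0 \<inter> {..p} \<union> {i. i \<ge> 1 \<and> x i \<in> U} \<inter> {p<..}"
    have "{i. i \<ge> 1 \<and> x i \<in> U} \<subseteq> E \<union> {..p}" by (auto simp: E_def)
    then have E: "infinite E" "0 \<notin> E"
      using visits zero_notin_digit_set[OF w0] finite_subset by (auto simp: E_def)
    obtain \<omega>\<^sub>1 where w1: "\<omega>\<^sub>1 \<in> {0<..1}" "digit_set \<omega>\<^sub>1 = E" using digit_set_surj[OF E] by blast
    define n where "n = max m p"
    \<comment> \<open>The first \<open>q\<close> digits determine all terms indexed by the block, and \<open>p \<le> q\<close> keeps the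
      resulting dyadic interval inside \<open>W\<close>.\<close>
    obtain q where q: "\<And>k. k \<in> J n \<Longrightarrow> enumerate E (k - 1) \<le> q" "p \<le> q"
    proof -
      have "finite (insert p ((\<lambda>k. enumerate E (k - 1)) ` J n))" using J(1) by simp
      then show thesis using that unfolding finite_nat_set_iff_bounded_le by auto
    qed
    define c where "c = real_of_int \<lceil>2 ^ q * \<omega>\<^sub>1\<rceil>"
    \<comment> \<open>The numbers sharing their first \<open>q\<close> digits with \<open>\<omega>\<^sub>1\<close> form a half-open interval; its interior
      need not contain \<open>\<omega>\<^sub>1\<close> but suffices.\<close>
    define I where "I = {(c - 1) / 2 ^ q <..< c / 2 ^ q}"
    have cylinder: "digit_set v \<inter> {..q} = E \<inter> {..q}" "v \<in> {0<..1}" if v: "v \<in> I" for v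
    proof -
      have v': "c - 1 < 2 ^ q * v" "2 ^ q * v < c"
        using v by (auto simp: I_def field_simps)
      have "\<lceil>2 ^ q * \<omega>\<^sub>1\<rceil> \<ge> 1" using w1(1) by (simp add: one_le_ceiling)
      moreover have "\<lceil>2 ^ q * \<omega>\<^sub>1\<rceil> \<le> 2 ^ q" using w1(1) by (simp add: ceiling_le_iff)
      ultimately have c: "1 \<le> c" "c \<le> 2 ^ q"
        unfolding c_def by (simp, metis of_int_le_iff of_int_numeral of_int_power)
      have "0 < 2 ^ q * v" using v' c by linarith
      then have "0 < v" by (simp add: zero_less_mult_iff)
      moreover have "2 ^ q * v \<le> 2 ^ q * 1" using v' c by linarith
      then have "v \<le> 1" by (rule mult_left_le_imp_le) simp
      ultimately show v1: "v \<in> {0<..1}" by simp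
      have "\<lceil>2 ^ q * v\<rceil> = \<lceil>2 ^ q * \<omega>\<^sub>1\<rceil>"
        using v' by (intro ceiling_unique) (auto simp: c_def)
      then show "digit_set v \<inter> {..q} = E \<inter> {..q}"
        using digits_agree_if_ceiling_eq v1 w1 by metis
    qed
    have "I \<inter> ?B = {}"
    proof -
      have "(x \<restriction> v) k \<in> U" if v: "v \<in> I" and k: "k \<in> J n" for v k
      proof -
        have "enumerate (digit_set v) (k - 1) = enumerate E (k - 1)"
          using cylinder[OF v] E(1) q(1)[OF k]
          by (intro enumerate_cong_initial_segment[of _ _ q] digit_set_infinite) auto
        moreover have "n < k" using J(2)[of n] k by blast
        then have "k - 1 \<ge> p" unfolding n_def by linarith
        then have "enumerate E (k - 1) > p" using less_enumerate[OF E, of "k - 1"] by simp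
        then have "x (enumerate E (k - 1)) \<in> U"
          using enumerate_in_set[OF E(1), of "k - 1"] by (auto simp: E_def)
        ultimately show ?thesis by (simp add: subsequence_at_def digit_set_def)
      qed
      moreover have "n \<ge> m" by (simp add: n_def)
      ultimately show ?thesis by blast
    qed
    moreover have "I \<subseteq> W"
    proof
      fix v assume v: "v \<in> I"
      have "digit_set v \<inter> {..p} = digit_set \<omega>\<^sub>0 \<inter> {..p}"
      proof -
        have "digit_set v \<inter> {..p} = digit_set v \<inter> {..q} \<inter> {..p}" using q(2) by auto
        also have "\<dots> = E \<inter> {..q} \<inter> {..p}" using cylinder(1)[OF v] by simp
        also have "\<dots> = digit_set \<omega>\<^sub>0 \<inter> {..p}" using q(2) by (auto simp: E_def)
        finally show ?thesis .
      qed
      then have "\<lceil>2 ^ p * v\<rceil> = \<lceil>2 ^ p * \<omega>\<^sub>0\<rceil>"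
        by (rule ceiling_eq_if_digits_agree[OF cylinder(2)[OF v] w0])
      then have "\<bar>2 ^ p * \<omega>\<^sub>0 - 2 ^ p * v\<bar> < 1" by linarith
      then have "2 ^ p * \<bar>\<omega>\<^sub>0 - v\<bar> < 1" by (simp add: abs_mult flip: right_diff_distrib)
      then have "\<bar>\<omega>\<^sub>0 - v\<bar> < (1/2) ^ p" by (simp add: field_simps power_divide)
      then have "v \<in> ball \<omega>\<^sub>0 e" using p by (simp add: dist_real_def)
      then show "v \<in> W" using e(2) cylinder(2)[OF v] by blast
    qed
    moreover obtain v where v: "v \<in> I"
    proof -
      have "(c - 1) / 2 ^ q < c / 2 ^ q" by (simp add: divide_strict_right_mono)
      then show thesis using that dense unfolding I_def by auto
    qed
    ultimately have "v \<in> ?T closure_of ?B" using sub by blast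
    moreover have "openin ?T I"
    proof -
      have "I \<subseteq> {0<..1}" using cylinder(2) by blast
      then show ?thesis by (simp add: open_subset I_def)
    qed
    ultimately have "\<exists>y\<in>?B. y \<in> I" using v unfolding in_closure_of by blast
    then show False using \<open>I \<inter> ?B = {}\<close> by blast
  qed
  then have "?T interior_of (?T closure_of ?B) = {}"
    by (metis (no_types, lifting) all_not_in_conv interior_of_subset openin_interior_of)
  then show ?thesis by (auto simp: nowhere_dense_in_def)
qed

text \<open>
  It is the set \<open>C\<close> of cluster points, all of whose neighbourhoods are visited infinitely often, that is
  plainly closed, so separability is applied to it. An open set meeting \<open>C\<close> meets its countable dense
  subset \<open>D\<close>, hence contains a member of a countable neighbourhood base of some point of \<open>D\<close>; these
  members are visited infinitely often because \<open>D \<subseteq> C\<close>.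
\<close>

lemma countable_family_at_cluster_points:
  fixes x :: "nat \<Rightarrow> 'a::first_countable_topology"
  assumes sep: "\<And>C :: 'a set. closed C \<Longrightarrow> separable_space (top_of_set C)"
  shows "\<exists>\<U>. countable \<U> \<and> (\<forall>U\<in>\<U>. infinite {i. i \<ge> 1 \<and> x i \<in> U}) \<and>
           (\<forall>l\<in>limit_points x. \<forall>V. open V \<and> l \<in> V \<longrightarrow> (\<exists>U\<in>\<U>. U \<subseteq> V))"
proof -
  define C where "C = {l. \<forall>V. open V \<and> l \<in> V \<longrightarrow> infinite {i. i \<ge> 1 \<and> x i \<in> V}}"
  have "open (- C)"
  proof (subst open_subopen, intro ballI)
    fix l assume "l \<in> - C"
    then obtain V where "open V" "l \<in> V" "finite {i. i \<ge> 1 \<and> x i \<in> V}" by (auto simp: C_def)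
    moreover from this have "V \<subseteq> - C" by (auto simp: C_def)
    ultimately show "\<exists>T. open T \<and> l \<in> T \<and> T \<subseteq> - C" by blast
  qed
  then have "separable_space (top_of_set C)" by (intro sep) (simp add: closed_def)
  then obtain D where D: "countable D" "D \<subseteq> C" "top_of_set C closure_of D = C"
    unfolding separable_space_def by auto
  have "\<forall>d. \<exists>A :: nat \<Rightarrow> 'a set. (\<forall>i. d \<in> A i \<and> open (A i)) \<and>
      (\<forall>S. open S \<and> d \<in> S \<longrightarrow> (\<exists>i. A i \<subseteq> S))"
    using first_countable_basis by blast
  then obtain A :: "'a \<Rightarrow> nat \<Rightarrow> 'a set" where
    A: "\<And>d i. d \<in> A d i \<and> open (A d i)" "\<And>d S. open S \<Longrightarrow> d \<in> S \<Longrightarrow> \<exists>i. A d i \<subseteq> S"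
    by metis
  let ?\<U> = "\<Union>d\<in>D. range (A d)"
  have "countable ?\<U>" using D(1) by simp
  moreover have "\<forall>U\<in>?\<U>. infinite {i. i \<ge> 1 \<and> x i \<in> U}"
    using D(2) A(1) by (auto simp: C_def)
  moreover have "\<forall>l\<in>limit_points x. \<forall>V. open V \<and> l \<in> V \<longrightarrow> (\<exists>U\<in>?\<U>. U \<subseteq> V)"
  proof (intro ballI allI impI)
    fix l V assume l: "l \<in> limit_points x" and "open V \<and> l \<in> V"
    then have V: "open V" "l \<in> V" by simp_all
    have "l \<in> C"
    proof (unfold C_def, clarify)
      fix V assume V: "open V" "l \<in> V" "finite {i. i \<ge> 1 \<and> x i \<in> V}"
      obtain n where n: "strict_mono_on {1..} n" "n ` {1..} \<subseteq> {1..}"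
          "(\<lambda>k. x (n k)) \<longlonglongrightarrow> l"
        using l by (auto simp: ideal_limit_points_def)
      obtain N where N: "\<And>k. k \<ge> N \<Longrightarrow> x (n k) \<in> V"
        using topological_tendstoD[OF n(3) V(1,2)] by (auto simp: eventually_sequentially)
      have "n ` {Suc N..} \<subseteq> {i. i \<ge> 1 \<and> x i \<in> V}"
      proof (rule image_subsetI)
        fix k assume "k \<in> {Suc N..}"
        then have "N \<le> k" "n k \<in> n ` {1..}" by auto
        then show "n k \<in> {i. i \<ge> 1 \<and> x i \<in> V}" using N n(2) by auto
      qed
      then have "finite (n ` {Suc N..})" using V(3) finite_subset by blast
      moreover have "inj_on n {Suc N..}"
        using strict_mono_on_imp_inj_on[OF n(1)] by (rule inj_on_subset) auto
      ultimately have "finite {Suc N..}" using finite_imageD by blast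
      then show False using infinite_Ici by blast
    qed
    then have "l \<in> top_of_set C closure_of D" using D(3) by simp
    moreover have "openin (top_of_set C) (C \<inter> V)" using V(1) by (rule openin_open_Int)
    ultimately obtain d where d: "d \<in> D" "d \<in> V"
      using \<open>l \<in> C\<close> V(2) unfolding in_closure_of by blast
    then obtain i where "A d i \<subseteq> V" using A(2)[OF V(1)] by blast
    then show "\<exists>U\<in>?\<U>. U \<subseteq> V" using d(1) by blast
  qed
  ultimately show ?thesis by (intro exI[of _ ?\<U>] conjI)
qed

text \<open>
  The neighbourhood base is run through along blocks of increasing index: the union of the chosen
  blocks is outside the ideal, and all but finitely many of its elements index terms inside any given
  neighbourhood.
\<close>

lemma ideal_limit_pointI_blocks:
  fixes y :: "nat \<Rightarrow> 'a::first_countable_topology"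
  assumes id: "ideal_on_N \<I>" and blocks: "escaping_blocks \<I> J"
    and freq: "\<And>V m. open V \<Longrightarrow> l \<in> V \<Longrightarrow> \<exists>n\<ge>m. \<forall>k\<in>J n. y k \<in> V"
  shows "l \<in> \<Lambda> y \<I>"
proof -
  have J: "finite (J n)" "J n \<subseteq> {n<..}" for n using blocks by (auto simp: escaping_blocks_def)
  obtain V :: "nat \<Rightarrow> 'a set" where V: "\<And>i. open (V i)" "\<And>i. l \<in> V i"
      "\<And>S. open S \<Longrightarrow> l \<in> S \<Longrightarrow> \<forall>\<^sub>F i in sequentially. V i \<subseteq> S"
    by (rule countable_basis_at_decseq[of l]) blast
  have "\<exists>h. \<forall>i. (\<forall>k\<in>J (h i). y k \<in> V i) \<and> h i < h (Suc i)"
  proof (rule dependent_nat_choice)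
    show "\<exists>n. \<forall>k\<in>J n. y k \<in> V 0" using freq V(1,2) by blast
    show "\<exists>n'. (\<forall>k\<in>J n'. y k \<in> V (Suc i)) \<and> n < n'" for n i
      using freq[OF V(1,2), of "Suc n" "Suc i"] by (auto simp: Suc_le_eq)
  qed
  then obtain h where h: "\<And>i k. k \<in> J (h i) \<Longrightarrow> y k \<in> V i" "\<And>i. h i < h (Suc i)" by blast
  define A where "A = (\<Union>n\<in>range h. J n)"
  have "strict_mono h" using h(2) by (simp add: strict_mono_Suc_iff)
  then have "infinite (range h)" by (simp add: strict_mono_imp_inj_on range_inj_infinite)
  then have A_notin: "A \<notin> \<I>" using blocks unfolding A_def escaping_blocks_def by blast
  have A_pos: "A \<subseteq> {1..}" using J(2) by (fastforce simp: A_def)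
  have A_inf: "infinite A" using A_notin A_pos id by (auto simp: ideal_on_N_def)
  have cofin: "finite {k \<in> A. y k \<notin> S}" if S: "open S" "l \<in> S" for S
  proof -
    obtain i where i: "\<And>j. j \<ge> i \<Longrightarrow> V j \<subseteq> S"
      using V(3)[OF S] by (auto simp: eventually_sequentially)
    have "{k \<in> A. y k \<notin> S} \<subseteq> (\<Union>j<i. J (h j))"
    proof
      fix k assume "k \<in> {k \<in> A. y k \<notin> S}"
      then obtain j where j: "k \<in> J (h j)" "y k \<notin> S" by (auto simp: A_def)
      then have "\<not> j \<ge> i" using i h(1) by blast
      then show "k \<in> (\<Union>j<i. J (h j))" using j by auto
    qed
    then show ?thesis using J(1) finite_subset by blast
  qed
  define n where "n k = enumerate A (k - 1)" for k
  have img: "n ` {1..} = A"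
  proof -
    have "n ` {1..} = enumerate A ` ((\<lambda>k. k - 1) ` {1..})" by (simp add: n_def image_image)
    also have "(\<lambda>k. k - 1) ` {1..} = (UNIV :: nat set)"
      by (auto simp: image_iff intro!: bexI[of _ "Suc _"])
    finally show ?thesis using range_enumerate[OF A_inf] by simp
  qed
  have mono: "strict_mono_on {1..} n"
    using A_inf by (auto simp: strict_mono_on_def n_def)
  have "(\<lambda>k. y (n k)) \<longlonglongrightarrow> l"
  proof (rule topological_tendstoI)
    fix S assume S: "open S" "l \<in> S"
    have "{k \<in> {1..}. y (n k) \<notin> S} \<subseteq> {1..} \<inter> n -` {k \<in> A. y k \<notin> S}" using img by auto
    moreover have "finite ({1..} \<inter> n -` {k \<in> A. y k \<notin> S})"
      using finite_vimage_IntI[OF cofin[OF S] strict_mono_on_imp_inj_on[OF mono]]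
      by (simp add: Int_commute)
    ultimately have "finite {k \<in> {1..}. y (n k) \<notin> S}" by (rule finite_subset)
    then have "finite ({k \<in> {1..}. y (n k) \<notin> S} \<union> {0})" by simp
    moreover have "{k. y (n k) \<notin> S} \<subseteq> {k \<in> {1..}. y (n k) \<notin> S} \<union> {0}"
      by (auto simp: Suc_le_eq)
    ultimately have "finite {k. y (n k) \<notin> S}" by (rule finite_subset[rotated])
    then show "\<forall>\<^sub>F k in sequentially. y (n k) \<in> S"
      by (simp add: eventually_cofinite flip: cofinite_eq_sequentially)
  qed
  then show ?thesis
    unfolding ideal_limit_points_def using mono img A_pos A_notin by blast
qed

lemma limit_points_subsequence_subset:
  fixes x :: "nat \<Rightarrow> 'a::topological_space"
  assumes w: "\<omega> \<in> {0<..1}"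
  shows "\<Lambda> (x \<restriction> \<omega>) \<I> \<subseteq> limit_points x"
proof
  fix l assume "l \<in> \<Lambda> (x \<restriction> \<omega>) \<I>"
  then obtain n where n: "strict_mono_on {1..} n" "n ` {1..} \<subseteq> {1..}"
      "(\<lambda>k. (x \<restriction> \<omega>) (n k)) \<longlonglongrightarrow> l"
    by (auto simp: ideal_limit_points_def)
  define r where "r k = enumerate (digit_set \<omega>) (n k - 1)" for k
  have "strict_mono_on {1..} r"
  proof (rule strict_mono_onI)
    fix i j :: nat assume ij: "i \<in> {1..}" "j \<in> {1..}" "i < j"
    then have "n i < n j" "n i \<ge> 1" using n(1,2) by (auto simp: strict_mono_on_def)
    then show "r i < r j" using digit_set_infinite[OF w] by (simp add: r_def)
  qed
  moreover have "r k \<ge> 1" for k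
    using less_enumerate[OF digit_set_infinite[OF w] zero_notin_digit_set[OF w], of "n k - 1"]
    by (simp add: r_def)
  then have "r ` {1..} \<subseteq> {1..}" by auto
  moreover have "(\<lambda>k. x (r k)) \<longlonglongrightarrow> l"
    using n(3) by (simp add: subsequence_at_def r_def digit_set_def)
  moreover have "r ` {1..} \<notin> Fin"
  proof
    assume "r ` {1..} \<in> Fin"
    then have "finite {1::nat..}"
      using finite_imageD[OF _ strict_mono_on_imp_inj_on[OF \<open>strict_mono_on {1..} r\<close>]]
      by (simp add: Fin_def)
    then show False using infinite_Ici by blast
  qed
  ultimately show "l \<in> limit_points x" unfolding ideal_limit_points_def by blast
qed

text \<open>
  There is one nowhere dense exceptional set for each \<open>U\<close> in the countable family and each lower bound
  \<open>m\<close> on the block index, hence countably many in all.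
\<close>

lemma comeager_limit_points_preserved:
  fixes x :: "nat \<Rightarrow> 'a::first_countable_topology"
  assumes sep: "\<And>C :: 'a set. closed C \<Longrightarrow> separable_space (top_of_set C)"
    and id: "ideal_on_N \<I>" and blocks: "escaping_blocks \<I> J"
  shows "comeager_in (top_of_set {0<..1}) {\<omega> \<in> {0<..1::real}. \<Lambda> (x \<restriction> \<omega>) \<I> = limit_points x}"
proof -
  let ?T = "top_of_set {0<..1::real}"
  obtain \<U> where U: "countable \<U>" "\<And>U. U \<in> \<U> \<Longrightarrow> infinite {i. i \<ge> 1 \<and> x i \<in> U}"
      "\<And>l V. l \<in> limit_points x \<Longrightarrow> open V \<Longrightarrow> l \<in> V \<Longrightarrow> \<exists>U\<in>\<U>. U \<subseteq> V"
    using countable_family_at_cluster_points[OF sep, of x] by metis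
  define N where "N = (\<lambda>(U, m). {\<omega> \<in> {0<..1::real}. \<not> (\<exists>n\<ge>m. \<forall>k\<in>J n. (x \<restriction> \<omega>) k \<in> U)})"
  have "\<Lambda> (x \<restriction> \<omega>) \<I> = limit_points x"
    if w: "\<omega> \<in> {0<..1}" "\<omega> \<notin> \<Union>(N ` (\<U> \<times> UNIV))" for \<omega>
  proof (rule subset_antisym[OF limit_points_subsequence_subset[OF w(1)]], rule subsetI)
    fix l assume l: "l \<in> limit_points x"
    show "l \<in> \<Lambda> (x \<restriction> \<omega>) \<I>"
    proof (rule ideal_limit_pointI_blocks[OF id blocks])
      fix V m assume "open V" "l \<in> V"
      then obtain U where "U \<in> \<U>" "U \<subseteq> V" using U(3)[OF l] by blast
      moreover have "\<exists>n\<ge>m. \<forall>k\<in>J n. (x \<restriction> \<omega>) k \<in> U"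
        using w \<open>U \<in> \<U>\<close> by (auto simp: N_def)
      ultimately show "\<exists>n\<ge>m. \<forall>k\<in>J n. (x \<restriction> \<omega>) k \<in> V" by blast
    qed
  qed
  then have "{0<..1} - {\<omega> \<in> {0<..1}. \<Lambda> (x \<restriction> \<omega>) \<I> = limit_points x} \<subseteq> \<Union>(N ` (\<U> \<times> UNIV))"
    by blast
  moreover have "nowhere_dense_in ?T B" if mem: "B \<in> N ` (\<U> \<times> UNIV)" for B
  proof -
    obtain U m where B: "U \<in> \<U>" "B = N (U, m)" using mem by blast
    show ?thesis unfolding B(2) N_def prod.case
      by (rule block_in_open_set_generic) (use blocks U(2)[OF B(1)] in \<open>auto simp: escaping_blocks_def\<close>)
  qed
  moreover have "countable (N ` (\<U> \<times> UNIV))" using U(1) by simp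
  ultimately have "meager_in ?T ({0<..1} - {\<omega> \<in> {0<..1}. \<Lambda> (x \<restriction> \<omega>) \<I> = limit_points x})"
    by (intro meager_in_Union) auto
  then show ?thesis by (auto simp: comeager_in_def)
qed

theorem theorem2p3:
  fixes x :: "nat \<Rightarrow> 'a::first_countable_topology"
    and \<I> :: "nat set set"
  assumes "\<And>C :: 'a set. closed C \<Longrightarrow> separable_space (top_of_set C)"
    and "generalized_density_ideal \<I> \<or> F_sigma_ideal \<I>"
  shows "(\<not> meager_in (top_of_set {0<..1}) {\<omega> \<in> {0<..1::real}. \<Lambda> (x \<restriction> \<omega>) \<I> = \<Lambda> x \<I>}
            \<longleftrightarrow> \<Lambda> x \<I> = limit_points x) \<and>
         (\<Lambda> x \<I> = limit_points x \<longrightarrow>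
            comeager_in (top_of_set {0<..1}) {\<omega> \<in> {0<..1::real}. \<Lambda> (x \<restriction> \<omega>) \<I> = \<Lambda> x \<I>})"
proof -
  let ?T = "top_of_set {0<..1::real}"
  let ?S = "{\<omega> \<in> {0<..1::real}. \<Lambda> (x \<restriction> \<omega>) \<I> = \<Lambda> x \<I>}"
  let ?G = "{\<omega> \<in> {0<..1::real}. \<Lambda> (x \<restriction> \<omega>) \<I> = limit_points x}"
  have id: "ideal_on_N \<I>"
    using assms(2) by (auto simp: generalized_density_ideal_def F_sigma_ideal_def)
  obtain J where "escaping_blocks \<I> J"
    using assms(2) F_sigma_ideal_has_escaping_blocks density_family_has_escaping_blocks
    unfolding generalized_density_ideal_def by metis
  then have G: "comeager_in ?T ?G"
    using comeager_limit_points_preserved[OF assms(1) id] by blast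
  then have co: "meager_in ?T ({0<..1} - ?G)" by (simp add: comeager_in_def)
  show ?thesis
  proof (cases "\<Lambda> x \<I> = limit_points x")
    case True
    have "\<not> meager_in ?T ?G"
    proof
      assume "meager_in ?T ?G"
      then have "meager_in ?T (?G \<union> ({0<..1} - ?G))" using co by (rule meager_in_Un)
      then show False using unit_interval_not_meager meager_in_subset by blast
    qed
    with G show ?thesis unfolding True by blast
  next
    case False
    then have "?S \<subseteq> {0<..1} - ?G" by auto
    then have "meager_in ?T ?S" by (rule meager_in_subset[OF co])
    with False show ?thesis by blast
  qed
qed

end
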